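(* Let $(\mathcal M, M, \overline a)$ and $(\mathcal N, N, \overline b)$ be pointed systems of the same parameter size in the same language $L$. The following are equivalent. (1) Eloise has a winning strategy in the modal Ehrenfeucht-Fraïssé game $\mathrm{MEF}(\mathcal M, M,\overline a,\mathcal N,N,\overline b)$. (2) $(\mathcal M,M,\overline a)$ is $L^{\Diamond}_\infty$-elementarily equivalent to $(\mathcal N,N,\overline b)$, i.e. for every $L^{\Diamond}_\infty$-formula $\phi$, $\mathcal M,M\vDash\phi[\overline a]$ if and only if $\mathcal N,N\vDash\phi[\overline b]$. (3) There is a bisimulation $\sim$ between $\mathcal M$ and $\mathcal N$ with $(M,\overline a)\sim(N,\overline b)$.
   Context: Fix a first-order finitary non-modal language $L$. A potentialist system is a collection of $L$-structures, called worlds, together with a collection of embeddings between them, containing the identity embeddings and all compositions of embeddings. The collection of worlds, and the collection of embeddings, may be a proper class. "$\pi\colon M\to M'$ in $\mathcal M$" means that $\pi$ is one of the embeddings of $\mathcal M$. To make sense of satisfaction in class-sized systems one can work within Morse-Kelley set theory, or Von Neumann-Bernays-Gödel set theory with the axiom of elementary transfinite recursion, or alternatively with a sequence of Grothendieck-Zermelo universes, so that the extension of a potentialist system in one universe is a set in the next universe up. A pointed system is a triple $(\mathcal M,M,\overline a)$ with $\mathcal M$ a potentialist system, $M\in\mathcal M$ and $\overline a$ a finite tuple of elements of $M$; its parameter size is the length of $\overline a$. $\pi(\overline a)$ is taken componentwise and $\overline a c$ is $\overline a$ with $c$ appended. The language $L^{\Diamond}_\infty$ is the class-sized union, over all infinite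 cardinals $\kappa$, of the languages $L^{\Diamond}_\kappa$, where $L^{\Diamond}_\kappa$ is the first-order language based on $L$ with the additional modal operators $\Diamond,\Box$, in which conjunctions and disjunctions of size less than $\kappa$ are allowed, with the proviso that all formulas contain only finitely many free variables. (So conjunctions and disjunctions are set-sized.) Satisfaction: the non-modal clauses are as usual in $M$; $\mathcal M,M\vDash\Diamond\phi[\overline a]$ iff there is $\pi\colon M\to M'$ in $\mathcal M$ with $\mathcal M,M'\vDash\phi[\pi(\overline a)]$; $\mathcal M,M\vDash\Box\phi[\overline a]$ iff for every $\pi\colon M\to M'$ in $\mathcal M$, $\mathcal M,M'\vDash\phi[\pi(\overline a)]$. A bisimulation between $\mathcal M$ and $\mathcal N$ is a non-empty relation $\sim$ matching pairs $(M,\overline a)$ with pairs $(N,\overline b)$, where $(\mathcal M,M,\overline a)$, $(\mathcal N,N,\overline b)$ are pointed systems of the same parameter size, such that whenever $(M,\overline a)\sim(N,\overline b)$: (B1) $\overline a\mapsto\overline b$ is a partial isomorphism between $M$ and $N$, i.e. $\overline a$ in $M$ and $\overline b$ in $N$ satisfy the same atomic formulas; (B2) for any $c\in M$ there is $d\in N$ with $(M,\overline a c)\sim(N,\overline b d)$, and vice versa; (B3) for any $\pi\colon M\to M'$ in $\mathcal M$ there is $\rho\colon N\to N'$ in $\mathcal N$ with $(M',\pi(\overline a))\sim(N',\rho(\overline b))$, and vice versa. The game $\mathrm{MEF}(\mathcal M,M,\overline a,\mathcal N,N,\overline b)$ is played by Abelard and Eloise. Positions are quadruples $(U,\overline c,V,\overline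 d)$ with $(\mathcal M,U,\overline c)$ and $(\mathcal N,V,\overline d)$ pointed systems of the same parameter size; the initial position is $(M,\overline a,N,\overline b)$. From $(U,\overline c,V,\overline d)$ Abelard either (a) chooses $u\in U$ or $v\in V$, or (b) chooses $\pi\colon U\to U'$ in $\mathcal M$ or $\rho\colon V\to V'$ in $\mathcal N$. Eloise responds respectively by (a) choosing an element of the other structure, so that both $u\in U$ and $v\in V$ are chosen, the new position being $(U,\overline c u,V,\overline d v)$; or (b) choosing an embedding in the other system, so that both $\pi\colon U\to U'$ in $\mathcal M$ and $\rho\colon V\to V'$ in $\mathcal N$ are chosen, the new position being $(U',\pi(\overline c),V',\rho(\overline d))$. A play is an $\omega$-sequence of positions and is won by Eloise iff at every position $(U,\overline c,V,\overline d)$ of the play $\overline c$ in $U$ and $\overline d$ in $V$ satisfy the same atomic formulas.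
   Formalization: Both systems (worlds, embeddings, domains) are assumed to be sets in the universe over which the cardinals κ of the language range; for proper-class systems with only set-sized conjunctions, (2) does not imply (3). *)

theory Defs
  imports "HOL-Library.FuncSet"
begin

unbundle cardinal_syntax

section \<open>Structures and embeddings\<close>

record ('f, 'r) lang =
  funs :: "'f set"
  farity :: "'f \<Rightarrow> nat"
  rels :: "'r set"
  rarity :: "'r \<Rightarrow> nat"

record ('a, 'f, 'r) struct =
  carrier :: "'a set"
  fint :: "'f \<Rightarrow> 'a list \<Rightarrow> 'a"
  rint :: "'r \<Rightarrow> 'a list set"

definition tuples :: "'a set \<Rightarrow> nat \<Rightarrow> 'a list set" where
  "tuples A n = {xs. set xs \<subseteq> A \<and> length xs = n}"

text \<open>Interpretations are extensional, so that two structures are equal as records exactly if they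
  have the same domain and interpret the symbols of the language in the same way.\<close>

definition is_struct :: "('f, 'r) lang \<Rightarrow> ('a, 'f, 'r) struct \<Rightarrow> bool" where
  "is_struct L M \<longleftrightarrow>
     carrier M \<noteq> {} \<and>
     fint M \<in> (\<Pi>\<^sub>E f \<in> funs L. tuples (carrier M) (farity L f) \<rightarrow>\<^sub>E carrier M) \<and>
     rint M \<in> (\<Pi>\<^sub>E r \<in> rels L. Pow (tuples (carrier M) (rarity L r)))"

definition embedding ::
  "('f, 'r) lang \<Rightarrow> ('a, 'f, 'r) struct \<Rightarrow> ('a, 'f, 'r) struct \<Rightarrow> ('a \<Rightarrow> 'a) \<Rightarrow> bool" where
  "embedding L M M' h \<longleftrightarrow>
     h \<in> carrier M \<rightarrow>\<^sub>E carrier M' \<and> inj_on h (carrier M) \<and>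
     (\<forall>f \<in> funs L. \<forall>xs \<in> tuples (carrier M) (farity L f).
        h (fint M f xs) = fint M' f (map h xs)) \<and>
     (\<forall>r \<in> rels L. \<forall>xs \<in> tuples (carrier M) (rarity L r).
        xs \<in> rint M r \<longleftrightarrow> map h xs \<in> rint M' r)"

section \<open>Potentialist systems\<close>

text \<open>A triple \<open>(M, h, M')\<close> in \<open>embs\<close> is an embedding \<open>h : M \<rightarrow> M'\<close> of the system.\<close>

record ('a, 'f, 'r) psystem =
  worlds :: "('a, 'f, 'r) struct set"
  embs :: "(('a, 'f, 'r) struct \<times> ('a \<Rightarrow> 'a) \<times> ('a, 'f, 'r) struct) set"

definition potentialist_system :: "('f, 'r) lang \<Rightarrow> ('a, 'f, 'r) psystem \<Rightarrow> bool" where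
  "potentialist_system L S \<longleftrightarrow>
     (\<forall>M \<in> worlds S. is_struct L M) \<and>
     (\<forall>(M, h, M') \<in> embs S. M \<in> worlds S \<and> M' \<in> worlds S \<and> embedding L M M' h) \<and>
     (\<forall>M \<in> worlds S. (M, (\<lambda>x \<in> carrier M. x), M) \<in> embs S) \<and>
     (\<forall>M h M' h' M''. (M, h, M') \<in> embs S \<longrightarrow> (M', h', M'') \<in> embs S \<longrightarrow>
        (M, compose (carrier M) h' h, M'') \<in> embs S)"

type_synonym ('a, 'f, 'r) point = "('a, 'f, 'r) struct \<times> 'a list"

definition pointed_system ::
  "('f, 'r) lang \<Rightarrow> ('a, 'f, 'r) psystem \<Rightarrow> ('a, 'f, 'r) point \<Rightarrow> bool" where
  "pointed_system L S P \<longleftrightarrow>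
     potentialist_system L S \<and> fst P \<in> worlds S \<and> set (snd P) \<subseteq> carrier (fst P)"

section \<open>Infinitary modal formulas\<close>

datatype 'f tm = Var nat | App 'f "'f tm list"

datatype ('f, 'r) atom = Eq "'f tm" "'f tm" | Rel 'r "'f tm list"

text \<open>The type \<open>'i\<close> supplies the index sets of conjunctions and disjunctions, and the cardinals
  \<open>\<kappa>\<close>. It plays the role of the universe of sets in which the language \<open>L\<^sub>\<infinity>\<close> is a class.\<close>

datatype ('f, 'r, 'i) fm =
    FAtom "('f, 'r) atom"
  | FNeg "('f, 'r, 'i) fm"
  | FConj "'i set" "'i \<Rightarrow> ('f, 'r, 'i) fm"
  | FDisj "'i set" "'i \<Rightarrow> ('f, 'r, 'i) fm"
  | FEx nat "('f, 'r, 'i) fm"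
  | FAll nat "('f, 'r, 'i) fm"
  | FDia "('f, 'r, 'i) fm"
  | FBox "('f, 'r, 'i) fm"

fun wf_tm :: "('f, 'r) lang \<Rightarrow> 'f tm \<Rightarrow> bool" where
  "wf_tm L (Var x) = True"
| "wf_tm L (App f ts) = (f \<in> funs L \<and> length ts = farity L f \<and> (\<forall>t \<in> set ts. wf_tm L t))"

fun wf_atom :: "('f, 'r) lang \<Rightarrow> ('f, 'r) atom \<Rightarrow> bool" where
  "wf_atom L (Eq t u) = (wf_tm L t \<and> wf_tm L u)"
| "wf_atom L (Rel r ts) = (r \<in> rels L \<and> length ts = rarity L r \<and> (\<forall>t \<in> set ts. wf_tm L t))"

fun fv_tm :: "'f tm \<Rightarrow> nat set" where
  "fv_tm (Var x) = {x}"
| "fv_tm (App f ts) = (\<Union>t \<in> set ts. fv_tm t)"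

fun fv_atom :: "('f, 'r) atom \<Rightarrow> nat set" where
  "fv_atom (Eq t u) = fv_tm t \<union> fv_tm u"
| "fv_atom (Rel r ts) = (\<Union>t \<in> set ts. fv_tm t)"

primrec fv :: "('f, 'r, 'i) fm \<Rightarrow> nat set" where
  "fv (FAtom \<alpha>) = fv_atom \<alpha>"
| "fv (FNeg \<phi>) = fv \<phi>"
| "fv (FConj I \<Phi>) = (\<Union>i \<in> I. fv (\<Phi> i))"
| "fv (FDisj I \<Phi>) = (\<Union>i \<in> I. fv (\<Phi> i))"
| "fv (FEx x \<phi>) = fv \<phi> - {x}"
| "fv (FAll x \<phi>) = fv \<phi> - {x}"
| "fv (FDia \<phi>) = fv \<phi>"
| "fv (FBox \<phi>) = fv \<phi>"

inductive_set L_kappa :: "('f, 'r) lang \<Rightarrow> 'i rel \<Rightarrow> ('f, 'r, 'i) fm set"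
  for L :: "('f, 'r) lang" and \<kappa> :: "'i rel" where
  atom: "wf_atom L \<alpha> \<Longrightarrow> FAtom \<alpha> \<in> L_kappa L \<kappa>"
| neg: "\<phi> \<in> L_kappa L \<kappa> \<Longrightarrow> FNeg \<phi> \<in> L_kappa L \<kappa>"
| conj: "\<lbrakk>|I| <o \<kappa>; \<And>i. i \<in> I \<Longrightarrow> \<Phi> i \<in> L_kappa L \<kappa>; finite (fv (FConj I \<Phi>))\<rbrakk>
    \<Longrightarrow> FConj I \<Phi> \<in> L_kappa L \<kappa>"
| disj: "\<lbrakk>|I| <o \<kappa>; \<And>i. i \<in> I \<Longrightarrow> \<Phi> i \<in> L_kappa L \<kappa>; finite (fv (FDisj I \<Phi>))\<rbrakk>
    \<Longrightarrow> FDisj I \<Phi> \<in> L_kappa L \<kappa>"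
| ex: "\<phi> \<in> L_kappa L \<kappa> \<Longrightarrow> FEx x \<phi> \<in> L_kappa L \<kappa>"
| all: "\<phi> \<in> L_kappa L \<kappa> \<Longrightarrow> FAll x \<phi> \<in> L_kappa L \<kappa>"
| dia: "\<phi> \<in> L_kappa L \<kappa> \<Longrightarrow> FDia \<phi> \<in> L_kappa L \<kappa>"
| box: "\<phi> \<in> L_kappa L \<kappa> \<Longrightarrow> FBox \<phi> \<in> L_kappa L \<kappa>"

definition L_infty :: "('f, 'r) lang \<Rightarrow> ('f, 'r, 'i) fm set" where
  "L_infty L = \<Union> {L_kappa L \<kappa> | \<kappa> :: 'i rel. Card_order \<kappa> \<and> infinite (Field \<kappa>)}"

fun eval_tm :: "('a, 'f, 'r) struct \<Rightarrow> (nat \<Rightarrow> 'a) \<Rightarrow> 'f tm \<Rightarrow> 'a" where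
  "eval_tm M s (Var x) = s x"
| "eval_tm M s (App f ts) = fint M f (map (eval_tm M s) ts)"

fun sat_atom :: "('a, 'f, 'r) struct \<Rightarrow> (nat \<Rightarrow> 'a) \<Rightarrow> ('f, 'r) atom \<Rightarrow> bool" where
  "sat_atom M s (Eq t u) = (eval_tm M s t = eval_tm M s u)"
| "sat_atom M s (Rel r ts) = (map (eval_tm M s) ts \<in> rint M r)"

primrec sat ::
  "('a, 'f, 'r) psystem \<Rightarrow> ('f, 'r, 'i) fm \<Rightarrow> ('a, 'f, 'r) struct \<Rightarrow> (nat \<Rightarrow> 'a) \<Rightarrow> bool" where
  "sat S (FAtom \<alpha>) M s = sat_atom M s \<alpha>"
| "sat S (FNeg \<phi>) M s = (\<not> sat S \<phi> M s)"
| "sat S (FConj I \<Phi>) M s = (\<forall>i \<in> I. sat S (\<Phi> i) M s)"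
| "sat S (FDisj I \<Phi>) M s = (\<exists>i \<in> I. sat S (\<Phi> i) M s)"
| "sat S (FEx x \<phi>) M s = (\<exists>c \<in> carrier M. sat S \<phi> M (s(x := c)))"
| "sat S (FAll x \<phi>) M s = (\<forall>c \<in> carrier M. sat S \<phi> M (s(x := c)))"
| "sat S (FDia \<phi>) M s = (\<exists>h M'. (M, h, M') \<in> embs S \<and> sat S \<phi> M' (h \<circ> s))"
| "sat S (FBox \<phi>) M s = (\<forall>h M'. (M, h, M') \<in> embs S \<longrightarrow> sat S \<phi> M' (h \<circ> s))"

text \<open>A formula is applied to a tuple \<open>a\<close> by assigning \<open>a ! i\<close> to the variable \<open>i\<close>; the values of
  \<open>(!) a\<close> beyond the length of \<open>a\<close> play no role, as the free variables lie below it.\<close>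

definition same_atomic ::
  "('f, 'r) lang \<Rightarrow> ('a, 'f, 'r) point \<Rightarrow> ('b, 'f, 'r) point \<Rightarrow> bool" where
  "same_atomic L P Q \<longleftrightarrow>
     length (snd P) = length (snd Q) \<and>
     (\<forall>\<alpha>. wf_atom L \<alpha> \<longrightarrow> fv_atom \<alpha> \<subseteq> {..<length (snd P)} \<longrightarrow>
        (sat_atom (fst P) ((!) (snd P)) \<alpha> \<longleftrightarrow> sat_atom (fst Q) ((!) (snd Q)) \<alpha>))"

definition L_infty_equivalent ::
  "'i itself \<Rightarrow> ('f, 'r) lang \<Rightarrow> ('a, 'f, 'r) psystem \<Rightarrow> ('a, 'f, 'r) point \<Rightarrow>
   ('b, 'f, 'r) psystem \<Rightarrow> ('b, 'f, 'r) point \<Rightarrow> bool" where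
  "L_infty_equivalent _ L S P T Q \<longleftrightarrow>
     (\<forall>\<phi> :: ('f, 'r, 'i) fm. \<phi> \<in> L_infty L \<longrightarrow> fv \<phi> \<subseteq> {..<length (snd P)} \<longrightarrow>
        (sat S \<phi> (fst P) ((!) (snd P)) \<longleftrightarrow> sat T \<phi> (fst Q) ((!) (snd Q))))"

text \<open>The system is a set in the universe \<open>'i\<close>. For every system this holds for all large enough
  types \<open>'i\<close>, so it bounds \<open>'i\<close> from below rather than restricting the system. Some such bound is
  needed for elementary equivalence to yield a bisimulation: a world may have too many outgoing
  embeddings for a conjunction over all of them.\<close>

definition set_sized :: "'i itself \<Rightarrow> ('a, 'f, 'r) psystem \<Rightarrow> bool" where
  "set_sized _ S \<longleftrightarrow>
     |worlds S| <o |UNIV :: 'i set| \<and>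
     |embs S| <o |UNIV :: 'i set| \<and>
     (\<forall>M \<in> worlds S. |carrier M| <o |UNIV :: 'i set| )"

section \<open>Bisimulations\<close>

definition bisimulation ::
  "('f, 'r) lang \<Rightarrow> ('a, 'f, 'r) psystem \<Rightarrow> ('b, 'f, 'r) psystem \<Rightarrow>
   (('a, 'f, 'r) point \<times> ('b, 'f, 'r) point) set \<Rightarrow> bool" where
  "bisimulation L S T R \<longleftrightarrow>
     R \<noteq> {} \<and>
     (\<forall>M a N b. ((M, a), (N, b)) \<in> R \<longrightarrow>
        pointed_system L S (M, a) \<and> pointed_system L T (N, b) \<and> length a = length b \<and>
        same_atomic L (M, a) (N, b) \<and>
        (\<forall>c \<in> carrier M. \<exists>d \<in> carrier N. ((M, a @ [c]), (N, b @ [d])) \<in> R) \<and>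
        (\<forall>d \<in> carrier N. \<exists>c \<in> carrier M. ((M, a @ [c]), (N, b @ [d])) \<in> R) \<and>
        (\<forall>h M'. (M, h, M') \<in> embs S \<longrightarrow>
           (\<exists>k N'. (N, k, N') \<in> embs T \<and> ((M', map h a), (N', map k b)) \<in> R)) \<and>
        (\<forall>k N'. (N, k, N') \<in> embs T \<longrightarrow>
           (\<exists>h M'. (M, h, M') \<in> embs S \<and> ((M', map h a), (N', map k b)) \<in> R)))"

section \<open>The modal Ehrenfeucht-Fraisse game\<close>

text \<open>A position \<open>(U, c, V, d)\<close> is represented as the pair of points \<open>((U, c), (V, d))\<close>.\<close>

type_synonym ('a, 'b, 'f, 'r) position = "('a, 'f, 'r) point \<times> ('b, 'f, 'r) point"

definition position ::
  "('f, 'r) lang \<Rightarrow> ('a, 'f, 'r) psystem \<Rightarrow> ('b, 'f, 'r) psystem \<Rightarrow>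
   ('a, 'b, 'f, 'r) position \<Rightarrow> bool" where
  "position L S T p \<longleftrightarrow>
     pointed_system L S (fst p) \<and> pointed_system L T (snd p) \<and>
     length (snd (fst p)) = length (snd (snd p))"

datatype ('a, 'f, 'r) choice = Elem 'a | Emb "'a \<Rightarrow> 'a" "('a, 'f, 'r) struct"

fun legal :: "('a, 'f, 'r) psystem \<Rightarrow> ('a, 'f, 'r) point \<Rightarrow> ('a, 'f, 'r) choice \<Rightarrow> bool" where
  "legal S (U, c) (Elem u) = (u \<in> carrier U)"
| "legal S (U, c) (Emb h U') = ((U, h, U') \<in> embs S)"

fun step :: "('a, 'f, 'r) point \<Rightarrow> ('a, 'f, 'r) choice \<Rightarrow> ('a, 'f, 'r) point" where
  "step (U, c) (Elem u) = (U, c @ [u])"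
| "step (U, c) (Emb h U') = (U', map h c)"

fun same_kind :: "('a, 'f, 'r) choice \<Rightarrow> ('b, 'f, 'r) choice \<Rightarrow> bool" where
  "same_kind (Elem _) (Elem _) = True"
| "same_kind (Emb _ _) (Emb _ _) = True"
| "same_kind _ _ = False"

text \<open>A strategy of Eloise is a pair: \<open>\<sigma>\<close> answers Abelard's choices on the left, \<open>\<tau>\<close> those on the
  right. Both may depend on the list of all positions so far, the current one being the last.\<close>

type_synonym ('a, 'b, 'f, 'r) strategy =
  "(('a, 'b, 'f, 'r) position list \<Rightarrow> ('a, 'f, 'r) choice \<Rightarrow> ('b, 'f, 'r) choice) \<times>
   (('a, 'b, 'f, 'r) position list \<Rightarrow> ('b, 'f, 'r) choice \<Rightarrow> ('a, 'f, 'r) choice)"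

definition is_strategy ::
  "('f, 'r) lang \<Rightarrow> ('a, 'f, 'r) psystem \<Rightarrow> ('b, 'f, 'r) psystem \<Rightarrow>
   ('a, 'b, 'f, 'r) strategy \<Rightarrow> bool" where
  "is_strategy L S T = (\<lambda>(\<sigma>, \<tau>).
     \<forall>ps P Q. position L S T (P, Q) \<longrightarrow>
       (\<forall>m. legal S P m \<longrightarrow>
          legal T Q (\<sigma> (ps @ [(P, Q)]) m) \<and> same_kind m (\<sigma> (ps @ [(P, Q)]) m)) \<and>
       (\<forall>m. legal T Q m \<longrightarrow>
          legal S P (\<tau> (ps @ [(P, Q)]) m) \<and> same_kind m (\<tau> (ps @ [(P, Q)]) m)))"

definition play_with ::
  "('a, 'f, 'r) psystem \<Rightarrow> ('b, 'f, 'r) psystem \<Rightarrow> ('a, 'b, 'f, 'r) strategy \<Rightarrow>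
   ('a, 'b, 'f, 'r) position \<Rightarrow> (nat \<Rightarrow> ('a, 'b, 'f, 'r) position) \<Rightarrow> bool" where
  "play_with S T = (\<lambda>(\<sigma>, \<tau>) p\<^sub>0 p.
     p 0 = p\<^sub>0 \<and>
     (\<forall>n. let P = fst (p n); Q = snd (p n); history = map p [0..<Suc n] in
        (\<exists>m. legal S P m \<and> p (Suc n) = (step P m, step Q (\<sigma> history m))) \<or>
        (\<exists>m. legal T Q m \<and> p (Suc n) = (step P (\<tau> history m), step Q m))))"

definition won_by_Eloise ::
  "('f, 'r) lang \<Rightarrow> (nat \<Rightarrow> ('a, 'b, 'f, 'r) position) \<Rightarrow> bool" where
  "won_by_Eloise L p \<longleftrightarrow> (\<forall>n. same_atomic L (fst (p n)) (snd (p n)))"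

definition Eloise_wins_MEF ::
  "('f, 'r) lang \<Rightarrow> ('a, 'f, 'r) psystem \<Rightarrow> ('a, 'f, 'r) point \<Rightarrow>
   ('b, 'f, 'r) psystem \<Rightarrow> ('b, 'f, 'r) point \<Rightarrow> bool" where
  "Eloise_wins_MEF L S P T Q \<longleftrightarrow>
     (\<exists>st. is_strategy L S T st \<and> (\<forall>p. play_with S T st (P, Q) p \<longrightarrow> won_by_Eloise L p))"

end

theory Submission
  imports Defs
begin

text \<open>
  The equivalence of the game with bisimilarity holds because a bisimulation is exactly a set of
  positions that Eloise can keep the play inside. Given a bisimulation, she always answers with the
  witness that the back-and-forth clauses provide, and the same atomic formulas hold throughout
  (\<open>bisimulation_imp_Eloise_wins\<close>). Conversely, given a winning strategy, the positions reachable
  under it form a bisimulation: her answers are the witnesses, and each reachable position agrees on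
  atomic formulas because the finite history leading to it can be prolonged to a full play
  (\<open>Eloise_wins_imp_bisimulation\<close>). A strategy may look at the past, so histories rather than
  positions are what one has to keep track of.

  Bisimilar points satisfy the same formulas by induction on the formula: quantifiers are matched by
  the clause for elements and modal operators by the clause for embeddings (\<open>sat_bisimilar\<close>).
  Conversely, \<open>L\<^sub>\<infinity>\<close>-equivalence itself is a bisimulation. If some element \<open>c\<close> had no partner,
  every candidate \<open>d\<close> would be excluded by a formula true of \<open>c\<close> and false of \<open>d\<close>; the existential
  quantification of the conjunction of all these formulas would then tell the two original points
  apart. For an embedding without a partner one uses \<open>\<diamond>\<close> in place of the existential quantifier
  (\<open>L_infty_equivalence_bisimulation\<close>). The size bound is what makes this conjunction available: it has one
  conjunct for each candidate partner, and there are fewer of these than elements of the index type.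
\<close>

section \<open>Points and moves\<close>

lemma pointed_system_step:
  assumes "pointed_system L S P" and "legal S P m"
  shows "pointed_system L S (step P m)"
proof (cases P)
  case [simp]: (Pair U c)
  show ?thesis
  proof (cases m)
    case (Elem u)
    then show ?thesis using assms by (auto simp: pointed_system_def)
  next
    case (Emb h U')
    with assms have "(U, h, U') \<in> embs S" by simp
    with assms(1) have "U' \<in> worlds S" "embedding L U U' h"
      by (fastforce simp: pointed_system_def potentialist_system_def)+
    with assms(1) Emb show ?thesis
      by (auto simp: pointed_system_def embedding_def)
  qed
qed

lemma length_step:
  "same_kind m m' \<Longrightarrow> length (snd P) = length (snd Q) \<Longrightarrow>
    length (snd (step P m)) = length (snd (step Q m'))"
  by (cases P; cases Q; cases m; cases m') auto

text \<open>Worlds are non-empty and identities belong to the system, so no player ever gets stuck.\<close>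

lemma answer_of_same_kind:
  assumes "pointed_system L T Q"
  obtains m' where "legal T Q m'" and "same_kind m m'"
proof (cases m)
  case (Elem u)
  from assms have "carrier (fst Q) \<noteq> {}"
    by (simp add: pointed_system_def potentialist_system_def is_struct_def)
  then obtain v where "v \<in> carrier (fst Q)" by blast
  then show ?thesis using that[of "Elem v"] Elem by (cases Q) auto
next
  case (Emb h U')
  from assms have "(fst Q, (\<lambda>x \<in> carrier (fst Q). x), fst Q) \<in> embs T"
    by (auto simp: pointed_system_def potentialist_system_def)
  then show ?thesis using that[of "Emb (\<lambda>x \<in> carrier (fst Q). x) (fst Q)"] Emb
    by (cases Q) auto
qed

lemma same_atomic_sym: "same_atomic L P Q \<Longrightarrow> same_atomic L Q P"
  by (auto simp: same_atomic_def)

lemma bisimulationD: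
  assumes "bisimulation L S T R" and "((M, a), (N, b)) \<in> R"
  shows "length a = length b" and "same_atomic L (M, a) (N, b)"
    and "\<forall>c \<in> carrier M. \<exists>d \<in> carrier N. ((M, a @ [c]), (N, b @ [d])) \<in> R"
    and "\<forall>d \<in> carrier N. \<exists>c \<in> carrier M. ((M, a @ [c]), (N, b @ [d])) \<in> R"
    and "\<forall>h M'. (M, h, M') \<in> embs S \<longrightarrow>
      (\<exists>k N'. (N, k, N') \<in> embs T \<and> ((M', map h a), (N', map k b)) \<in> R)"
    and "\<forall>k N'. (N, k, N') \<in> embs T \<longrightarrow>
      (\<exists>h M'. (M, h, M') \<in> embs S \<and> ((M', map h a), (N', map k b)) \<in> R)"
  using assms by (simp_all add: bisimulation_def)

lemma bisimulation_converse:
  assumes "bisimulation L S T R"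
  shows "bisimulation L T S (R\<inverse>)"
  unfolding bisimulation_def
proof (intro conjI allI impI ballI)
  show "R\<inverse> \<noteq> {}" using assms by (auto simp: bisimulation_def)
qed (use assms in \<open>simp_all add: bisimulation_def same_atomic_sym\<close>)

section \<open>Bisimilar points satisfy the same formulas\<close>

text \<open>A formula may reuse a variable below \<open>length a\<close> for a later choice, whereas a position only
  ever grows at its end. Evaluation of a formula is therefore linked to a position by a map \<open>e\<close> from
  variables to places of the tuple, and atomic formulas are transported along it.\<close>

fun rename_tm :: "(nat \<Rightarrow> nat) \<Rightarrow> 'f tm \<Rightarrow> 'f tm" where
  "rename_tm e (Var x) = Var (e x)"
| "rename_tm e (App f ts) = App f (map (rename_tm e) ts)"

fun rename_atom :: "(nat \<Rightarrow> nat) \<Rightarrow> ('f, 'r) atom \<Rightarrow> ('f, 'r) atom" where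
  "rename_atom e (Eq t u) = Eq (rename_tm e t) (rename_tm e u)"
| "rename_atom e (Rel r ts) = Rel r (map (rename_tm e) ts)"

lemma wf_rename_tm: "wf_tm L t \<Longrightarrow> wf_tm L (rename_tm e t)"
  by (induction t) auto

lemma fv_rename_tm: "fv_tm (rename_tm e t) = e ` fv_tm t"
  by (induction t) auto

lemma wf_rename_atom: "wf_atom L \<alpha> \<Longrightarrow> wf_atom L (rename_atom e \<alpha>)"
  by (cases \<alpha>) (auto simp: wf_rename_tm)

lemma fv_rename_atom: "fv_atom (rename_atom e \<alpha>) = e ` fv_atom \<alpha>"
  by (cases \<alpha>) (auto simp: fv_rename_tm)

lemma eval_rename_tm:
  "(\<And>x. x \<in> fv_tm t \<Longrightarrow> s x = s' (e x)) \<Longrightarrow> eval_tm M s' (rename_tm e t) = eval_tm M s t"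
proof (induction t)
  case (App f ts)
  then have "map (eval_tm M s' \<circ> rename_tm e) ts = map (eval_tm M s) ts" by auto
  then show ?case by (simp only: rename_tm.simps eval_tm.simps map_map)
qed simp

lemma sat_rename_atom:
  assumes "\<And>x. x \<in> fv_atom \<alpha> \<Longrightarrow> s x = s' (e x)"
  shows "sat_atom M s' (rename_atom e \<alpha>) \<longleftrightarrow> sat_atom M s \<alpha>"
proof (cases \<alpha>)
  case (Eq t u)
  then have "eval_tm M s' (rename_tm e t) = eval_tm M s t"
    "eval_tm M s' (rename_tm e u) = eval_tm M s u"
    using assms by (auto intro!: eval_rename_tm)
  then show ?thesis using Eq by simp
next
  case (Rel r ts)
  then have "map (eval_tm M s' \<circ> rename_tm e) ts = map (eval_tm M s) ts"
    using assms by (auto intro!: eval_rename_tm)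
  then show ?thesis using Rel by (simp only: rename_atom.simps sat_atom.simps map_map)
qed

text \<open>Under a quantifier the bound variable is redirected to the newly appended place; the moves of
  a bisimulation then match the clauses of satisfaction one by one. Letting \<open>e\<close> vary is what makes
  the induction go through when a quantifier binds a variable that is already in use.\<close>

lemma sat_bisimilar:
  assumes R: "bisimulation L S T R"
    and "\<phi> \<in> L_kappa L \<kappa>" and "((M, a), (N, b)) \<in> R"
    and "\<And>x. x \<in> fv \<phi> \<Longrightarrow> e x < length a \<and> s x = a ! e x \<and> t x = b ! e x"
  shows "sat S \<phi> M s \<longleftrightarrow> sat T \<phi> N t"
  using assms(2-)
proof (induction arbitrary: M a N b e s t rule: L_kappa.induct)
  case (atom \<alpha>)
  have "same_atomic L (M, a) (N, b)"
    using bisimulationD(2)[OF R atom.prems(1)] .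
  moreover have "fv_atom (rename_atom e \<alpha>) \<subseteq> {..<length a}"
    using atom.prems(2) by (auto simp: fv_rename_atom)
  ultimately have "sat_atom M ((!) a) (rename_atom e \<alpha>) = sat_atom N ((!) b) (rename_atom e \<alpha>)"
    using wf_rename_atom[OF atom.hyps] by (simp add: same_atomic_def)
  then show ?case
    using sat_rename_atom[of \<alpha> s "(!) a" e M] sat_rename_atom[of \<alpha> t "(!) b" e N] atom.prems(2)
    by simp
next
  case (neg \<phi>)
  then show ?case by (metis fv.simps(2) sat.simps(2))
next
  case (conj I \<Phi>)
  have "sat S (\<Phi> i) M s = sat T (\<Phi> i) N t" if "i \<in> I" for i
    by (rule conj.IH[OF that conj.prems(1), of e]) (use that conj.prems(2) in auto)
  then show ?case by simp
next
  case (disj I \<Phi>)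
  have "sat S (\<Phi> i) M s = sat T (\<Phi> i) N t" if "i \<in> I" for i
    by (rule disj.IH[OF that disj.prems(1), of e]) (use that disj.prems(2) in auto)
  then show ?case by simp
next
  case (ex \<phi> x)
  have len: "length a = length b"
    using bisimulationD(1)[OF R ex.prems(1)] .
  have *: "sat S \<phi> M (s(x := c)) = sat T \<phi> N (t(x := d))"
    if "((M, a @ [c]), (N, b @ [d])) \<in> R" for c d
    by (rule ex.IH[OF that, of "e(x := length a)"]) (use ex.prems(2) len in \<open>auto simp: nth_append less_SucI\<close>)
  show ?case
    unfolding sat.simps using * bisimulationD(3,4)[OF R ex.prems(1)] by meson
next
  case (all \<phi> x)
  have len: "length a = length b"
    using bisimulationD(1)[OF R all.prems(1)] .
  have *: "sat S \<phi> M (s(x := c)) = sat T \<phi> N (t(x := d))"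
    if "((M, a @ [c]), (N, b @ [d])) \<in> R" for c d
    by (rule all.IH[OF that, of "e(x := length a)"]) (use all.prems(2) len in \<open>auto simp: nth_append less_SucI\<close>)
  show ?case
    unfolding sat.simps using * bisimulationD(3,4)[OF R all.prems(1)] by meson
next
  case (dia \<phi>)
  have len: "length a = length b"
    using bisimulationD(1)[OF R dia.prems(1)] .
  have *: "sat S \<phi> M' (h \<circ> s) = sat T \<phi> N' (k \<circ> t)"
    if "((M', map h a), (N', map k b)) \<in> R" for h M' k N'
    by (rule dia.IH[OF that, of e]) (use dia.prems(2) len in auto)
  show ?case
    unfolding sat.simps using * bisimulationD(5,6)[OF R dia.prems(1)] by meson
next
  case (box \<phi>)
  have len: "length a = length b"
    using bisimulationD(1)[OF R box.prems(1)] .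
  have *: "sat S \<phi> M' (h \<circ> s) = sat T \<phi> N' (k \<circ> t)"
    if "((M', map h a), (N', map k b)) \<in> R" for h M' k N'
    by (rule box.IH[OF that, of e]) (use box.prems(2) len in auto)
  show ?case
    unfolding sat.simps using * bisimulationD(5,6)[OF R box.prems(1)] by meson
qed

lemma bisimilar_imp_L_infty_equivalent:
  fixes L :: "('f, 'r) lang"
  assumes "bisimulation L S T R" and "((M, a), (N, b)) \<in> R"
  shows "L_infty_equivalent TYPE('i) L S (M, a) T (N, b)"
  unfolding L_infty_equivalent_def
proof (intro allI impI)
  fix \<phi> :: "('f, 'r, 'i) fm"
  assume "\<phi> \<in> L_infty L" and fv: "fv \<phi> \<subseteq> {..<length (snd (M, a))}"
  then obtain \<kappa> where "\<phi> \<in> L_kappa L \<kappa>" by (auto simp: L_infty_def)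
  from sat_bisimilar[OF assms(1) this assms(2), of id "(!) a" "(!) b"] fv
  show "sat S \<phi> (fst (M, a)) ((!) (snd (M, a))) = sat T \<phi> (fst (N, b)) ((!) (snd (N, b)))"
    by auto
qed

section \<open>Elementary equivalence is a bisimulation\<close>

lemma eval_tm_cong: "(\<And>x. x \<in> fv_tm t \<Longrightarrow> s x = s' x) \<Longrightarrow> eval_tm M s t = eval_tm M s' t"
proof (induction t)
  case (App f ts)
  then have "map (eval_tm M s) ts = map (eval_tm M s') ts" by auto
  then show ?case by (metis eval_tm.simps(2))
qed simp

lemma sat_atom_cong:
  assumes "\<And>x. x \<in> fv_atom \<alpha> \<Longrightarrow> s x = s' x"
  shows "sat_atom M s \<alpha> = sat_atom M s' \<alpha>"
proof (cases \<alpha>)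
  case (Eq t u)
  then show ?thesis using assms eval_tm_cong[of t s s' M] eval_tm_cong[of u s s' M] by simp
next
  case (Rel r ts)
  then have "map (eval_tm M s) ts = map (eval_tm M s') ts"
    using assms by (auto intro!: eval_tm_cong)
  then show ?thesis using Rel by (metis sat_atom.simps(2))
qed

lemma sat_cong: "(\<And>x. x \<in> fv \<phi> \<Longrightarrow> s x = s' x) \<Longrightarrow> sat S \<phi> M s = sat S \<phi> M s'"
proof (induction \<phi> arbitrary: M s s')
  case (FAtom \<alpha>)
  then show ?case by (simp add: sat_atom_cong[of \<alpha> s s'])
next
  case (FNeg \<phi>)
  from FNeg.IH[of s s' M] FNeg.prems show ?case by simp
next
  case (FConj I \<Phi>)
  have "sat S (\<Phi> i) M s = sat S (\<Phi> i) M s'" if "i \<in> I" for i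
    by (rule FConj.IH) (use that FConj.prems in auto)
  then show ?case by simp
next
  case (FDisj I \<Phi>)
  have "sat S (\<Phi> i) M s = sat S (\<Phi> i) M s'" if "i \<in> I" for i
    by (rule FDisj.IH) (use that FDisj.prems in auto)
  then show ?case by simp
next
  case (FEx x \<phi>)
  have "sat S \<phi> M (s(x := c)) = sat S \<phi> M (s'(x := c))" for c
    by (rule FEx.IH) (use FEx.prems in auto)
  then show ?case by simp
next
  case (FAll x \<phi>)
  have "sat S \<phi> M (s(x := c)) = sat S \<phi> M (s'(x := c))" for c
    by (rule FAll.IH) (use FAll.prems in auto)
  then show ?case by simp
next
  case (FDia \<phi>)
  have "sat S \<phi> M' (h \<circ> s) = sat S \<phi> M' (h \<circ> s')" for h M'
    by (rule FDia.IH) (use FDia.prems in auto)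
  then show ?case by simp
next
  case (FBox \<phi>)
  have "sat S \<phi> M' (h \<circ> s) = sat S \<phi> M' (h \<circ> s')" for h M'
    by (rule FBox.IH) (use FBox.prems in auto)
  then show ?case by simp
qed

lemma sat_nth_append:
  assumes "fv \<phi> \<subseteq> {..<Suc (length a)}"
  shows "sat S \<phi> M (((!) a)(length a := c)) = sat S \<phi> M ((!) (a @ [c]))"
  by (rule sat_cong) (use assms in \<open>auto simp: nth_append less_Suc_eq\<close>)

lemma sat_nth_map:
  assumes "fv \<phi> \<subseteq> {..<length a}"
  shows "sat S \<phi> M (h \<circ> (!) a) = sat S \<phi> M ((!) (map h a))"
  by (rule sat_cong) (use assms in auto)

lemma L_kappa_mono:
  assumes "\<kappa> \<le>o \<kappa>'" and "\<phi> \<in> L_kappa L \<kappa>"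
  shows "\<phi> \<in> L_kappa L \<kappa>'"
  using assms(2) by induction (auto intro: L_kappa.intros ordLess_ordLeq_trans[OF _ assms(1)])

text \<open>Every cardinal on the type \<open>'i\<close> is at most that of \<open>'i\<close> itself, so a single \<open>\<kappa>\<close> gives the whole
  language. Closure of the language under the connectives then follows from that of \<open>L\<^sub>\<kappa>\<close>.\<close>

lemma L_infty_eq_L_kappa_UNIV:
  assumes "infinite (UNIV :: 'i set)"
  shows "L_infty L = (L_kappa L |UNIV :: 'i set| :: ('f, 'r, 'i) fm set)"
proof
  show "L_infty L \<subseteq> (L_kappa L |UNIV :: 'i set| :: ('f, 'r, 'i) fm set)"
  proof
    fix \<phi> :: "('f, 'r, 'i) fm"
    assume "\<phi> \<in> L_infty L"
    then obtain \<kappa> :: "'i rel" where \<kappa>: "Card_order \<kappa>" "\<phi> \<in> L_kappa L \<kappa>"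
      by (auto simp: L_infty_def)
    have "\<kappa> \<le>o |UNIV :: 'i set|"
      using card_of_Field_ordIso[OF \<kappa>(1)] card_of_mono1[of "Field \<kappa>" UNIV]
      by (meson ordIso_ordLeq_trans ordIso_symmetric subset_UNIV)
    then show "\<phi> \<in> L_kappa L |UNIV :: 'i set|" using \<kappa>(2) by (rule L_kappa_mono)
  qed
  show "(L_kappa L |UNIV :: 'i set| :: ('f, 'r, 'i) fm set) \<subseteq> L_infty L"
    unfolding L_infty_def
  proof (rule Union_upper, rule CollectI, intro exI conjI)
    show "Card_order |UNIV :: 'i set|" by (rule card_of_Card_order)
    show "infinite (Field |UNIV :: 'i set| )" using assms by (simp add: Field_card_of)
  qed (rule refl)
qed

text \<open>The conjunction of a family indexed by an arbitrary set \<open>A\<close>, re-indexed along an injection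
  of \<open>A\<close> into \<open>'i\<close>. It is meaningful only if such an injection exists.\<close>

definition conj_over :: "'x set \<Rightarrow> ('x \<Rightarrow> ('f, 'r, 'i) fm) \<Rightarrow> ('f, 'r, 'i) fm" where
  "conj_over A \<Phi> =
     (let f = (SOME f :: 'x \<Rightarrow> 'i. inj_on f A) in FConj (f ` A) (\<lambda>i. \<Phi> (inv_into A f i)))"

lemma conj_over_unfold:
  fixes \<Phi> :: "'x \<Rightarrow> ('f, 'r, 'i) fm"
  assumes "|A| <o |UNIV :: 'i set|"
  obtains f :: "'x \<Rightarrow> 'i" where "inj_on f A"
    and "conj_over A \<Phi> = FConj (f ` A) (\<lambda>i. \<Phi> (inv_into A f i))"
proof -
  from assms have "\<exists>f :: 'x \<Rightarrow> 'i. inj_on f A"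
    using card_of_ordLeq[of A "UNIV :: 'i set"] ordLess_imp_ordLeq[OF assms] by auto
  then have "inj_on (SOME f :: 'x \<Rightarrow> 'i. inj_on f A) A" by (rule someI_ex)
  then show ?thesis by (rule that) (simp add: conj_over_def Let_def)
qed

lemma sat_conj_over:
  fixes \<Phi> :: "'x \<Rightarrow> ('f, 'r, 'i) fm"
  assumes "|A| <o |UNIV :: 'i set|"
  shows "sat S (conj_over A \<Phi>) M s \<longleftrightarrow> (\<forall>x \<in> A. sat S (\<Phi> x) M s)"
  using assms by (rule conj_over_unfold[of A \<Phi>]) simp

lemma fv_conj_over:
  fixes \<Phi> :: "'x \<Rightarrow> ('f, 'r, 'i) fm"
  assumes "|A| <o |UNIV :: 'i set|"
  shows "fv (conj_over A \<Phi>) = (\<Union>x \<in> A. fv (\<Phi> x))"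
  using assms by (rule conj_over_unfold[of A \<Phi>]) simp

lemma conj_over_in_L_infty:
  fixes \<Phi> :: "'x \<Rightarrow> ('f, 'r, 'i) fm"
  assumes "infinite (UNIV :: 'i set)" and A: "|A| <o |UNIV :: 'i set|"
    and "\<And>x. x \<in> A \<Longrightarrow> \<Phi> x \<in> L_infty L" and fv: "\<And>x. x \<in> A \<Longrightarrow> fv (\<Phi> x) \<subseteq> {..<n}"
  shows "conj_over A \<Phi> \<in> L_infty L"
proof -
  obtain f :: "'x \<Rightarrow> 'i" where f: "inj_on f A"
    "conj_over A \<Phi> = FConj (f ` A) (\<lambda>i. \<Phi> (inv_into A f i))"
    using conj_over_unfold[OF A] .
  have "|f ` A| <o |UNIV :: 'i set|"
    using card_of_image A by (rule ordLeq_ordLess_trans)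
  moreover have "fv (conj_over A \<Phi>) \<subseteq> {..<n}"
    unfolding fv_conj_over[OF A] using fv by auto
  then have "finite (fv (conj_over A \<Phi>))" by (rule finite_subset) simp
  ultimately show ?thesis
    using assms(3) f unfolding L_infty_eq_L_kappa_UNIV[OF assms(1)]
    by (auto intro!: L_kappa.conj)
qed

lemma L_infty_equivalent_sym:
  assumes "L_infty_equivalent TYPE('i) L S P T Q" and "length (snd P) = length (snd Q)"
  shows "L_infty_equivalent TYPE('i) L T Q S P"
  using assms by (auto simp: L_infty_equivalent_def)

text \<open>Equivalence is symmetric in the truth values, but a conjunction of separating formulas
  separates only if all of them are true on the same side; closure under negation arranges this.\<close>

lemma separating_formula:
  assumes "infinite (UNIV :: 'i set)" and "\<not> L_infty_equivalent TYPE('i) L S P T Q"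
  obtains \<phi> :: "('f, 'r, 'i) fm" where "\<phi> \<in> L_infty L" and "fv \<phi> \<subseteq> {..<length (snd P)}"
    and "sat S \<phi> (fst P) ((!) (snd P))" and "\<not> sat T \<phi> (fst Q) ((!) (snd Q))"
proof -
  from assms(2) obtain \<phi> :: "('f, 'r, 'i) fm" where \<phi>: "\<phi> \<in> L_infty L" "fv \<phi> \<subseteq> {..<length (snd P)}"
    "sat S \<phi> (fst P) ((!) (snd P)) \<noteq> sat T \<phi> (fst Q) ((!) (snd Q))"
    unfolding L_infty_equivalent_def by blast
  have "FNeg \<phi> \<in> L_infty L"
    using \<phi>(1) L_kappa.neg unfolding L_infty_eq_L_kappa_UNIV[OF assms(1)] by blast
  with \<phi> that[of \<phi>] that[of "FNeg \<phi>"] show ?thesis by auto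
qed

text \<open>One formula that is true at \<open>P\<close> and excludes all the rivals \<open>Q x\<close> at once, namely the
  conjunction of those separating \<open>P\<close> from each rival. This is where infinitary conjunctions enter.\<close>

lemma uniform_separating_formula:
  fixes Q :: "'x \<Rightarrow> ('b, 'f, 'r) point" and P :: "('a, 'f, 'r) point"
  assumes inf: "infinite (UNIV :: 'i set)" and A: "|A| <o |UNIV :: 'i set|"
    and sep: "\<And>x. x \<in> A \<Longrightarrow> \<not> L_infty_equivalent TYPE('i) L S P T (Q x)"
  obtains \<phi> :: "('f, 'r, 'i) fm" where "\<phi> \<in> L_infty L" and "fv \<phi> \<subseteq> {..<length (snd P)}"
    and "sat S \<phi> (fst P) ((!) (snd P))"
    and "\<And>x. x \<in> A \<Longrightarrow> \<not> sat T \<phi> (fst (Q x)) ((!) (snd (Q x)))"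
proof -
  have "\<forall>x \<in> A. \<exists>\<phi> :: ('f, 'r, 'i) fm. \<phi> \<in> L_infty L \<and> fv \<phi> \<subseteq> {..<length (snd P)} \<and>
    sat S \<phi> (fst P) ((!) (snd P)) \<and> \<not> sat T \<phi> (fst (Q x)) ((!) (snd (Q x)))"
    using separating_formula[OF inf sep] by metis
  from bchoice[OF this] obtain \<Phi> :: "'x \<Rightarrow> ('f, 'r, 'i) fm" where
    \<Phi>: "\<And>x. x \<in> A \<Longrightarrow> \<Phi> x \<in> L_infty L" "\<And>x. x \<in> A \<Longrightarrow> fv (\<Phi> x) \<subseteq> {..<length (snd P)}"
      "\<And>x. x \<in> A \<Longrightarrow> sat S (\<Phi> x) (fst P) ((!) (snd P))"
      "\<And>x. x \<in> A \<Longrightarrow> \<not> sat T (\<Phi> x) (fst (Q x)) ((!) (snd (Q x)))"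
    by blast
  show ?thesis
  proof (rule that[of "conj_over A \<Phi>"])
    show "conj_over A \<Phi> \<in> L_infty L"
      using inf A \<Phi>(1,2) by (rule conj_over_in_L_infty)
    show "fv (conj_over A \<Phi>) \<subseteq> {..<length (snd P)}"
      unfolding fv_conj_over[OF A] using \<Phi>(2) by blast
  qed (use \<Phi>(3,4) in \<open>auto simp: sat_conj_over[OF A]\<close>)
qed

text \<open>Without a partner \<open>d\<close> for \<open>c\<close>, the existential closure of a formula true of \<open>c\<close> and of no \<open>d\<close>
  would separate the two points.\<close>

lemma L_infty_equivalent_element:
  fixes S :: "('a, 'f, 'r) psystem" and T :: "('b, 'f, 'r) psystem"
  assumes inf: "infinite (UNIV :: 'i set)" and size: "set_sized TYPE('i) T" "N \<in> worlds T"
    and eq: "L_infty_equivalent TYPE('i) L S (M, a) T (N, b)" and len: "length a = length b"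
    and c: "c \<in> carrier M"
  shows "\<exists>d \<in> carrier N. L_infty_equivalent TYPE('i) L S (M, a @ [c]) T (N, b @ [d])"
proof (rule ccontr)
  assume "\<not> ?thesis"
  then have sep: "\<And>d. d \<in> carrier N \<Longrightarrow>
      \<not> L_infty_equivalent TYPE('i) L S (M, a @ [c]) T (N, b @ [d])" by blast
  have "|carrier N| <o |UNIV :: 'i set|" using size by (simp add: set_sized_def)
  from uniform_separating_formula[where Q = "\<lambda>d. (N, b @ [d])", OF inf this sep]
  obtain \<phi> :: "('f, 'r, 'i) fm" where \<phi>: "\<phi> \<in> L_infty L" "fv \<phi> \<subseteq> {..<Suc (length a)}"
    "sat S \<phi> M ((!) (a @ [c]))"
    "\<And>d. d \<in> carrier N \<Longrightarrow> \<not> sat T \<phi> N ((!) (b @ [d]))"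
    by auto
  let ?\<psi> = "FEx (length a) \<phi>"
  have "?\<psi> \<in> L_infty L"
    using \<phi>(1) L_kappa.ex unfolding L_infty_eq_L_kappa_UNIV[OF inf] by blast
  moreover have "fv ?\<psi> \<subseteq> {..<length a}" using \<phi>(2) by (auto simp: less_Suc_eq)
  moreover have "sat S ?\<psi> M ((!) a)"
    using c \<phi>(3) by (auto simp: sat_nth_append[OF \<phi>(2)])
  moreover have "\<not> sat T ?\<psi> N ((!) b)"
    using \<phi>(4) sat_nth_append[OF \<phi>(2)[unfolded len]] by (auto simp: len)
  ultimately show False using eq unfolding L_infty_equivalent_def fst_conv snd_conv by blast
qed

text \<open>The modal counterpart: a formula true at the target of \<open>h\<close> and at no point reached by an
  embedding of \<open>T\<close> would, prefixed with \<open>\<diamond>\<close>, separate the two points.\<close>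

lemma L_infty_equivalent_embedding:
  fixes S :: "('a, 'f, 'r) psystem" and T :: "('b, 'f, 'r) psystem"
  assumes inf: "infinite (UNIV :: 'i set)" and size: "set_sized TYPE('i) T"
    and eq: "L_infty_equivalent TYPE('i) L S (M, a) T (N, b)" and len: "length a = length b"
    and h: "(M, h, M') \<in> embs S"
  shows "\<exists>k N'. (N, k, N') \<in> embs T \<and>
    L_infty_equivalent TYPE('i) L S (M', map h a) T (N', map k b)"
proof (rule ccontr)
  assume neg: "\<not> ?thesis"
  \<comment> \<open>Only embeddings out of \<open>N\<close> are rivals; they keep their source so that \<open>?A\<close> lies inside \<open>embs T\<close>.\<close>
  let ?A = "{(K, k, N'). (K, k, N') \<in> embs T \<and> K = N}"
  have sep: "\<not> L_infty_equivalent TYPE('i) L S (M', map h a) T (snd (snd x), map (fst (snd x)) b)"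
    if "x \<in> ?A" for x using that neg by auto
  have "|?A| \<le>o |embs T|" by (rule card_of_mono1) auto
  moreover have "|embs T| <o |UNIV :: 'i set|" using size by (simp add: set_sized_def)
  ultimately have "|?A| <o |UNIV :: 'i set|" by (rule ordLeq_ordLess_trans)
  from uniform_separating_formula[where Q = "\<lambda>x. (snd (snd x), map (fst (snd x)) b)",
    OF inf this sep]
  obtain \<phi> :: "('f, 'r, 'i) fm" where \<phi>: "\<phi> \<in> L_infty L" "fv \<phi> \<subseteq> {..<length a}"
    "sat S \<phi> M' ((!) (map h a))"
    "\<And>x. x \<in> ?A \<Longrightarrow> \<not> sat T \<phi> (snd (snd x)) ((!) (map (fst (snd x)) b))"
    by auto
  have "FDia \<phi> \<in> L_infty L"
    using \<phi>(1) L_kappa.dia unfolding L_infty_eq_L_kappa_UNIV[OF inf] by blast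
  moreover have "fv (FDia \<phi>) \<subseteq> {..<length a}" using \<phi>(2) by simp
  moreover have "sat S (FDia \<phi>) M ((!) a)"
    using h \<phi>(3) by (auto simp: sat_nth_map[OF \<phi>(2)])
  moreover have "\<not> sat T (FDia \<phi>) N ((!) b)"
    using \<phi>(4)[of "(N, _, _)"] by (auto simp: sat_nth_map[OF \<phi>(2)[unfolded len]])
  ultimately show False using eq unfolding L_infty_equivalent_def fst_conv snd_conv by blast
qed

lemma L_infty_equivalent_imp_same_atomic:
  assumes inf: "infinite (UNIV :: 'i set)"
    and eq: "L_infty_equivalent TYPE('i) L S P T Q" and len: "length (snd P) = length (snd Q)"
  shows "same_atomic L P Q"
  unfolding same_atomic_def
proof (intro conjI allI impI)
  fix \<alpha> assume \<alpha>: "wf_atom L \<alpha>" "fv_atom \<alpha> \<subseteq> {..<length (snd P)}"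
  then have "(FAtom \<alpha> :: (_, _, 'i) fm) \<in> L_infty L"
    unfolding L_infty_eq_L_kappa_UNIV[OF inf] by (blast intro: L_kappa.atom)
  with eq \<alpha>(2) show "sat_atom (fst P) ((!) (snd P)) \<alpha> = sat_atom (fst Q) ((!) (snd Q)) \<alpha>"
    unfolding L_infty_equivalent_def by (metis fv.simps(1) sat.simps(1))
qed (rule len)

text \<open>The clauses for elements and embeddings are the two lemmas on \<open>L_infty_equivalent\<close> above,
  once for each side; by symmetry of elementary equivalence the right-hand versions need no separate
  argument.\<close>

lemma L_infty_equivalence_bisimulation:
  fixes L :: "('f, 'r) lang" and S :: "('a, 'f, 'r) psystem" and T :: "('b, 'f, 'r) psystem"
  assumes inf: "infinite (UNIV :: 'i set)"
    and size: "set_sized TYPE('i) S" "set_sized TYPE('i) T"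
  defines "R \<equiv> {(P, Q). position L S T (P, Q) \<and> L_infty_equivalent TYPE('i) L S P T Q}"
  assumes "R \<noteq> {}"
  shows "bisimulation L S T R"
  unfolding bisimulation_def
proof (intro conjI allI impI ballI)
  show "R \<noteq> {}" by fact
next
  fix M a N b
  assume "((M, a), (N, b)) \<in> R"
  then have P: "pointed_system L S (M, a)" and Q: "pointed_system L T (N, b)"
    and len: "length a = length b" and eq: "L_infty_equivalent TYPE('i) L S (M, a) T (N, b)"
    by (auto simp: R_def position_def)
  note eq' = L_infty_equivalent_sym[OF eq, simplified, OF len]
  have worlds: "M \<in> worlds S" "N \<in> worlds T" using P Q by (auto simp: pointed_system_def)
  have memI: "(step (M, a) m, step (N, b) m') \<in> R"
    if "legal S (M, a) m" "legal T (N, b) m'" "same_kind m m'"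
      "L_infty_equivalent TYPE('i) L S (step (M, a) m) T (step (N, b) m')" for m m'
    using that P Q len length_step[of m m' "(M, a)" "(N, b)"]
    by (auto simp: R_def position_def pointed_system_step)
  show "pointed_system L S (M, a)" "pointed_system L T (N, b)" "length a = length b"
    by (fact P Q len)+
  show "same_atomic L (M, a) (N, b)"
    using L_infty_equivalent_imp_same_atomic[OF inf eq] len by simp
  show "\<exists>d \<in> carrier N. ((M, a @ [c]), (N, b @ [d])) \<in> R" if c: "c \<in> carrier M" for c
  proof -
    from L_infty_equivalent_element[OF inf size(2) worlds(2) eq len c]
    obtain d where "d \<in> carrier N" "L_infty_equivalent TYPE('i) L S (M, a @ [c]) T (N, b @ [d])"
      by blast
    with c memI[of "Elem c" "Elem d"] show ?thesis by auto
  qed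
  show "\<exists>c \<in> carrier M. ((M, a @ [c]), (N, b @ [d])) \<in> R" if d: "d \<in> carrier N" for d
  proof -
    from L_infty_equivalent_element[OF inf size(1) worlds(1) eq' len[symmetric] d]
    obtain c where c: "c \<in> carrier M" "L_infty_equivalent TYPE('i) L T (N, b @ [d]) S (M, a @ [c])"
      by blast
    from L_infty_equivalent_sym[OF c(2)] len
    have "L_infty_equivalent TYPE('i) L S (M, a @ [c]) T (N, b @ [d])" by simp
    with c(1) d memI[of "Elem c" "Elem d"] show ?thesis by auto
  qed
  show "\<exists>k N'. (N, k, N') \<in> embs T \<and> ((M', map h a), (N', map k b)) \<in> R"
    if h: "(M, h, M') \<in> embs S" for h M'
  proof -
    from L_infty_equivalent_embedding[OF inf size(2) eq len h]
    obtain k N' where "(N, k, N') \<in> embs T"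
      "L_infty_equivalent TYPE('i) L S (M', map h a) T (N', map k b)" by blast
    with h memI[of "Emb h M'" "Emb k N'"] show ?thesis by auto
  qed
  show "\<exists>h M'. (M, h, M') \<in> embs S \<and> ((M', map h a), (N', map k b)) \<in> R"
    if k: "(N, k, N') \<in> embs T" for k N'
  proof -
    from L_infty_equivalent_embedding[OF inf size(1) eq' len[symmetric] k]
    obtain h M' where h: "(M, h, M') \<in> embs S"
      "L_infty_equivalent TYPE('i) L T (N', map k b) S (M', map h a)"
      by blast
    from L_infty_equivalent_sym[OF h(2)] len
    have "L_infty_equivalent TYPE('i) L S (M', map h a) T (N', map k b)" by simp
    with h(1) k memI[of "Emb h M'" "Emb k N'"] show ?thesis by auto
  qed
qed

section \<open>From a bisimulation to a winning strategy\<close>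

text \<open>Off the bisimulation only a legal answer of the same kind is claimed;
  a default is supplied there since a strategy has to answer at all
  positions, including those that it never lets happen.\<close>

lemma bisimulation_answer:
  assumes "bisimulation L S T R" and "pointed_system L T Q" and "legal S P m"
  shows "\<exists>m'. legal T Q m' \<and> same_kind m m' \<and> ((P, Q) \<in> R \<longrightarrow> (step P m, step Q m') \<in> R)"
proof (cases "(P, Q) \<in> R")
  case False
  then show ?thesis using answer_of_same_kind[OF assms(2), of m] by blast
next
  case True
  obtain M a N b where [simp]: "P = (M, a)" "Q = (N, b)" by (cases P, cases Q)
  from True have rel: "((M, a), (N, b)) \<in> R" by simp
  show ?thesis
  proof (cases m)
    case (Elem c)
    then have "c \<in> carrier M" using assms(3) by simp
    then obtain d where "d \<in> carrier N" "((M, a @ [c]), (N, b @ [d])) \<in> R"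
      using bisimulationD(3)[OF assms(1) rel] by blast
    with Elem show ?thesis by (intro exI[of _ "Elem d"]) auto
  next
    case (Emb h M')
    then have "(M, h, M') \<in> embs S" using assms(3) by simp
    then obtain k N' where "(N, k, N') \<in> embs T" "((M', map h a), (N', map k b)) \<in> R"
      using bisimulationD(5)[OF assms(1) rel] by blast
    with Emb show ?thesis by (intro exI[of _ "Emb k N'"]) auto
  qed
qed

text \<open>The strategy picks any legal answer that stays in \<open>R\<close> whenever the current position is in \<open>R\<close>;
  it consults the last position only. By induction the whole play stays in \<open>R\<close>. Answers to choices on
  the right come from the converse bisimulation.\<close>

lemma bisimulation_imp_Eloise_wins:
  fixes S :: "('a, 'f, 'r) psystem" and T :: "('b, 'f, 'r) psystem"
  assumes R: "bisimulation L S T R" and start: "(P, Q) \<in> R"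
  shows "Eloise_wins_MEF L S P T Q"
proof -
  define left where "left p m m' \<longleftrightarrow> legal T (snd p) m' \<and> same_kind m m' \<and>
    (p \<in> R \<longrightarrow> (step (fst p) m, step (snd p) m') \<in> R)"
    for p :: "('a, 'b, 'f, 'r) position" and m m'
  define right where "right p m m' \<longleftrightarrow> legal S (fst p) m' \<and> same_kind m m' \<and>
    (p \<in> R \<longrightarrow> (step (fst p) m', step (snd p) m) \<in> R)"
    for p :: "('a, 'b, 'f, 'r) position" and m m'
  define \<sigma> where "\<sigma> ps m = (SOME m'. left (last ps) m m')" for ps m
  define \<tau> where "\<tau> ps m = (SOME m'. right (last ps) m m')" for ps m
  have left: "left p m (\<sigma> (ps @ [p]) m)" if "position L S T p" "legal S (fst p) m" for ps p m
  proof -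
    have "\<exists>m'. left p m m'"
      using bisimulation_answer[OF R _ that(2), of "snd p"] that(1)
      by (simp add: left_def position_def)
    then show ?thesis by (simp add: \<sigma>_def someI_ex)
  qed
  have right: "right p m (\<tau> (ps @ [p]) m)" if "position L S T p" "legal T (snd p) m" for ps p m
  proof -
    have "\<exists>m'. right p m m'"
      using bisimulation_answer[OF bisimulation_converse[OF R] _ that(2), of "fst p"] that(1)
      by (simp add: right_def position_def)
    then show ?thesis by (simp add: \<tau>_def someI_ex)
  qed
  have pos: "position L S T p" if "p \<in> R" for p
    using R that unfolding bisimulation_def position_def by (cases p) auto
  have "is_strategy L S T (\<sigma>, \<tau>)"
    unfolding is_strategy_def using left right
    by (fastforce simp: left_def right_def)
  moreover have "won_by_Eloise L p" if "play_with S T (\<sigma>, \<tau>) (P, Q) p" for p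
  proof -
    have "p n \<in> R" for n
    proof (induction n)
      case 0
      then show ?case using that start by (simp add: play_with_def)
    next
      case (Suc n)
      have "map p [0..<Suc n] = map p [0..<n] @ [p n]" by simp
      with that have "(\<exists>m. legal S (fst (p n)) m \<and>
            p (Suc n) = (step (fst (p n)) m, step (snd (p n)) (\<sigma> (map p [0..<n] @ [p n]) m))) \<or>
          (\<exists>m. legal T (snd (p n)) m \<and>
            p (Suc n) = (step (fst (p n)) (\<tau> (map p [0..<n] @ [p n]) m), step (snd (p n)) m))"
        by (simp add: play_with_def Let_def)
      then show ?case
        using left[OF pos[OF Suc]] right[OF pos[OF Suc]] Suc by (auto simp: left_def right_def)
    qed
    then show ?thesis
      using R unfolding won_by_Eloise_def bisimulation_def by (metis prod.collapse)
  qed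
  ultimately show ?thesis unfolding Eloise_wins_MEF_def by blast
qed

section \<open>From a winning strategy to a bisimulation\<close>

text \<open>The rule by which \<open>play_with\<close> passes from one position to the next, isolated from any infinite
  play so that it applies to finite histories too.\<close>

definition turn ::
  "('a, 'f, 'r) psystem \<Rightarrow> ('b, 'f, 'r) psystem \<Rightarrow> ('a, 'b, 'f, 'r) strategy \<Rightarrow>
   ('a, 'b, 'f, 'r) position list \<Rightarrow> ('a, 'b, 'f, 'r) position \<Rightarrow> bool" where
  "turn S T st hs q \<longleftrightarrow>
     (let P = fst (last hs); Q = snd (last hs) in
        (\<exists>m. legal S P m \<and> q = (step P m, step Q (fst st hs m))) \<or>
        (\<exists>m. legal T Q m \<and> q = (step P (snd st hs m), step Q m)))"

lemma play_with_iff_turns: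
  "play_with S T st p\<^sub>0 p \<longleftrightarrow> p 0 = p\<^sub>0 \<and> (\<forall>n. turn S T st (map p [0..<Suc n]) (p (Suc n)))"
  by (cases st) (simp add: play_with_def turn_def Let_def)

inductive_set histories ::
  "('a, 'f, 'r) psystem \<Rightarrow> ('b, 'f, 'r) psystem \<Rightarrow> ('a, 'b, 'f, 'r) strategy \<Rightarrow>
   ('a, 'b, 'f, 'r) position \<Rightarrow> ('a, 'b, 'f, 'r) position list set"
  for S T st p\<^sub>0 where
  start: "[p\<^sub>0] \<in> histories S T st p\<^sub>0"
| turn: "hs \<in> histories S T st p\<^sub>0 \<Longrightarrow> turn S T st hs q \<Longrightarrow> hs @ [q] \<in> histories S T st p\<^sub>0"

lemma histories_nonempty: "hs \<in> histories S T st p\<^sub>0 \<Longrightarrow> hs \<noteq> []"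
  by (erule histories.cases) auto

lemma histories_nth:
  assumes "hs \<in> histories S T st p\<^sub>0"
  shows "hs ! 0 = p\<^sub>0 \<and> (\<forall>i. Suc i < length hs \<longrightarrow> turn S T st (take (Suc i) hs) (hs ! Suc i))"
  using assms
proof induction
  case (turn hs q)
  from histories_nonempty[OF turn.hyps(1)] turn show ?case
    by (auto simp: nth_append less_Suc_eq)
qed simp

text \<open>Repeatedly choosing some further turn gives longer and longer histories, each an initial
  segment of the next; the play is their limit.\<close>

lemma history_extends_to_play:
  assumes total: "\<And>hs. hs \<in> histories S T st p\<^sub>0 \<Longrightarrow> \<exists>q. turn S T st hs q"
    and hs: "hs \<in> histories S T st p\<^sub>0"
  obtains p n where "play_with S T st p\<^sub>0 p" and "p n = last hs"
proof -
  define g where "g k = ((\<lambda>xs. xs @ [SOME q. turn S T st xs q]) ^^ k) hs" for k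
  have g0: "g 0 = hs" and gSuc: "g (Suc k) = g k @ [SOME q. turn S T st (g k) q]" for k
    by (simp_all add: g_def)
  have g_hist: "g k \<in> histories S T st p\<^sub>0" for k
  proof (induction k)
    case (Suc k)
    then show ?case using someI_ex[OF total[OF Suc]] by (simp add: gSuc histories.turn)
  qed (simp add: g0 hs)
  have len: "length (g k) = length hs + k" for k by (induction k) (simp_all add: g0 gSuc)
  have ne: "0 < length hs" using histories_nonempty[OF hs] by simp
  have stable: "g (k + j) ! i = g k ! i" if "i < length hs + k" for i k j
    by (induction j) (use that in \<open>simp_all add: gSuc nth_append len\<close>)
  \<comment> \<open>Position \<open>i\<close> is already settled in \<open>g i\<close>, which has more than \<open>i\<close> entries as \<open>hs\<close> is non-empty.\<close>
  define p where "p i = g i ! i" for i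
  have p_eq: "p i = g k ! i" if "i < length hs + k" for i k
  proof (cases "k \<le> i")
    case True
    then show ?thesis using stable[OF that, of "i - k"] by (simp add: p_def)
  next
    case False
    then show ?thesis using stable[of i i "k - i"] ne by (simp add: p_def)
  qed
  have "turn S T st (map p [0..<Suc n]) (p (Suc n))" for n
  proof -
    have "map p [0..<Suc n] = take (Suc n) (g (Suc n))"
      by (rule nth_equalityI) (use len[of "Suc n"] ne p_eq[of _ "Suc n"] in \<open>auto simp del: upt_Suc\<close>)
    moreover have "Suc n < length (g (Suc n))" using len[of "Suc n"] ne by simp
    ultimately show ?thesis using histories_nth[OF g_hist[of "Suc n"]] by (simp add: p_def)
  qed
  moreover have "p 0 = p\<^sub>0" using histories_nth[OF g_hist[of 0]] by (simp add: p_def)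
  moreover have "p (length hs - 1) = last hs"
    using p_eq[of "length hs - 1" 0] ne by (simp add: g0 last_conv_nth)
  ultimately show ?thesis using that[of p "length hs - 1"] by (simp add: play_with_iff_turns)
qed

text \<open>The bisimulation consists of the last positions of all histories under a winning strategy.
  Playing one more turn stays in this set, which gives the back-and-forth clauses. As Abelard always
  has a legal choice, each history occurs within some play; since Eloise wins that play, the last
  position agrees on atomic formulas.\<close>

lemma Eloise_wins_imp_bisimulation:
  fixes S :: "('a, 'f, 'r) psystem" and T :: "('b, 'f, 'r) psystem"
  assumes win: "Eloise_wins_MEF L S P T Q" and start: "position L S T (P, Q)"
  shows "\<exists>R. bisimulation L S T R \<and> (P, Q) \<in> R"
proof -
  from win obtain st where st: "is_strategy L S T st"
    and won: "\<And>p. play_with S T st (P, Q) p \<Longrightarrow> won_by_Eloise L p"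
    unfolding Eloise_wins_MEF_def by blast
  obtain \<sigma> \<tau> where st_eq: "st = (\<sigma>, \<tau>)" by (cases st)
  let ?H = "histories S T st (P, Q)"
  have left: "legal T (snd (last hs)) (\<sigma> hs m) \<and> same_kind m (\<sigma> hs m)"
    if "hs \<noteq> []" "position L S T (last hs)" "legal S (fst (last hs)) m" for hs m
  proof -
    have "legal T Q (\<sigma> (ps @ [(P, Q)]) m) \<and> same_kind m (\<sigma> (ps @ [(P, Q)]) m)"
      if "position L S T (P, Q)" "legal S P m" for ps P Q
      using st that unfolding is_strategy_def st_eq prod.case by blast
    from this[of "fst (last hs)" "snd (last hs)" "butlast hs"] that show ?thesis by simp
  qed
  have right: "legal S (fst (last hs)) (\<tau> hs m) \<and> same_kind m (\<tau> hs m)"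
    if "hs \<noteq> []" "position L S T (last hs)" "legal T (snd (last hs)) m" for hs m
  proof -
    have "legal S P (\<tau> (ps @ [(P, Q)]) m) \<and> same_kind m (\<tau> (ps @ [(P, Q)]) m)"
      if "position L S T (P, Q)" "legal T Q m" for ps P Q
      using st that unfolding is_strategy_def st_eq prod.case by blast
    from this[of "fst (last hs)" "snd (last hs)" "butlast hs"] that show ?thesis by simp
  qed
  have pos: "position L S T (last hs)" if "hs \<in> ?H" for hs
    using that
  proof induction
    case start
    then show ?case using \<open>position L S T (P, Q)\<close> by simp
  next
    case (turn hs q)
    note ne = histories_nonempty[OF turn.hyps(1)]
    from turn.hyps(2) show ?case
      unfolding turn_def Let_def st_eq fst_conv snd_conv
    proof (elim disjE exE conjE)
      fix m assume m: "legal S (fst (last hs)) m"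
        and q: "q = (step (fst (last hs)) m, step (snd (last hs)) (\<sigma> hs m))"
      from left[OF ne turn.IH m] turn.IH m show ?thesis
        by (auto simp: q position_def intro: pointed_system_step length_step)
    next
      fix m assume m: "legal T (snd (last hs)) m"
        and q: "q = (step (fst (last hs)) (\<tau> hs m), step (snd (last hs)) m)"
      from right[OF ne turn.IH m] turn.IH m show ?thesis
        by (auto simp: q position_def intro: pointed_system_step length_step[symmetric])
    qed
  qed
  have total: "\<exists>q. turn S T st hs q" if "hs \<in> ?H" for hs
  proof -
    from pos[OF that] have "pointed_system L S (fst (last hs))" by (simp add: position_def)
    then obtain m where "legal S (fst (last hs)) m" by (rule answer_of_same_kind)
    then show ?thesis unfolding turn_def Let_def by blast
  qed
  have atomic: "same_atomic L (fst (last hs)) (snd (last hs))" if hs: "hs \<in> ?H" for hs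
  proof -
    obtain p n where "play_with S T st (P, Q) p" "p n = last hs"
      using history_extends_to_play[OF total hs] by blast
    with won show ?thesis unfolding won_by_Eloise_def by metis
  qed
  define R where "R = last ` ?H"
  have "(P, Q) \<in> R" unfolding R_def by (rule image_eqI[OF _ histories.start]) simp
  moreover have "bisimulation L S T R"
    unfolding bisimulation_def
  proof (intro conjI allI impI ballI)
    show "R \<noteq> {}" using \<open>(P, Q) \<in> R\<close> by blast
  next
    fix M a N b
    assume "((M, a), (N, b)) \<in> R"
    then obtain hs where hs: "hs \<in> ?H" and "((M, a), (N, b)) = last hs"
      unfolding R_def by (rule imageE)
    note last = this(2)[symmetric]
    from pos[OF hs] show "pointed_system L S (M, a)" "pointed_system L T (N, b)"
      "length a = length b" by (simp_all add: last position_def)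
    from atomic[OF hs] show "same_atomic L (M, a) (N, b)" by (simp add: last)
    have mem: "q \<in> R" if "turn S T st hs q" for q
      unfolding R_def by (rule image_eqI[OF _ histories.turn[OF hs that]]) simp
    have left': "\<exists>m'. legal T (N, b) m' \<and> same_kind m m' \<and> (step (M, a) m, step (N, b) m') \<in> R"
      if m: "legal S (M, a) m" for m
    proof -
      have "turn S T st hs (step (M, a) m, step (N, b) (\<sigma> hs m))"
        using m by (auto simp: turn_def Let_def last st_eq)
      from mem[OF this] left[OF histories_nonempty[OF hs] pos[OF hs], unfolded last, of m] m
      show ?thesis by auto
    qed
    have right': "\<exists>m'. legal S (M, a) m' \<and> same_kind m m' \<and> (step (M, a) m', step (N, b) m) \<in> R"
      if m: "legal T (N, b) m" for m
    proof -
      have "turn S T st hs (step (M, a) (\<tau> hs m), step (N, b) m)"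
        using m by (auto simp: turn_def Let_def last st_eq)
      from mem[OF this] right[OF histories_nonempty[OF hs] pos[OF hs], unfolded last, of m] m
      show ?thesis by auto
    qed
    show "\<exists>d \<in> carrier N. ((M, a @ [c]), (N, b @ [d])) \<in> R" if c: "c \<in> carrier M" for c
    proof -
      obtain m' where "legal T (N, b) m'" "same_kind (Elem c :: ('a, 'f, 'r) choice) m'"
        "(step (M, a) (Elem c), step (N, b) m') \<in> R" using left'[of "Elem c"] c by auto
      then show ?thesis by (cases m') auto
    qed
    show "\<exists>c \<in> carrier M. ((M, a @ [c]), (N, b @ [d])) \<in> R" if d: "d \<in> carrier N" for d
    proof -
      obtain m' where "legal S (M, a) m'" "same_kind (Elem d :: ('b, 'f, 'r) choice) m'"
        "(step (M, a) m', step (N, b) (Elem d)) \<in> R" using right'[of "Elem d"] d by auto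
      then show ?thesis by (cases m') auto
    qed
    show "\<exists>k N'. (N, k, N') \<in> embs T \<and> ((M', map h a), (N', map k b)) \<in> R"
      if h: "(M, h, M') \<in> embs S" for h M'
    proof -
      obtain m' where "legal T (N, b) m'" "same_kind (Emb h M') m'"
        "(step (M, a) (Emb h M'), step (N, b) m') \<in> R" using left'[of "Emb h M'"] h by auto
      then show ?thesis by (cases m') auto
    qed
    show "\<exists>h M'. (M, h, M') \<in> embs S \<and> ((M', map h a), (N', map k b)) \<in> R"
      if k: "(N, k, N') \<in> embs T" for k N'
    proof -
      obtain m' where "legal S (M, a) m'" "same_kind (Emb k N') m'"
        "(step (M, a) m', step (N, b) (Emb k N')) \<in> R" using right'[of "Emb k N'"] k by auto
      then show ?thesis by (cases m') auto
    qed
  qed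
  ultimately show ?thesis by blast
qed

section \<open>Equivalence of game, language and bisimilarity\<close>

theorem theorem36:
  fixes L :: "('f, 'r) lang"
    and \<M> :: "('a, 'f, 'r) psystem" and M :: "('a, 'f, 'r) struct" and a :: "'a list"
    and \<N> :: "('b, 'f, 'r) psystem" and N :: "('b, 'f, 'r) struct" and b :: "'b list"
  assumes "pointed_system L \<M> (M, a)" and "pointed_system L \<N> (N, b)"
    and "length a = length b"
    and "infinite (UNIV :: 'i set)"
    and "set_sized TYPE('i) \<M>" and "set_sized TYPE('i) \<N>"
  shows "(Eloise_wins_MEF L \<M> (M, a) \<N> (N, b) \<longleftrightarrow>
            L_infty_equivalent TYPE('i) L \<M> (M, a) \<N> (N, b)) \<and>
         (L_infty_equivalent TYPE('i) L \<M> (M, a) \<N> (N, b) \<longleftrightarrow>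
            (\<exists>R. bisimulation L \<M> \<N> R \<and> ((M, a), (N, b)) \<in> R))"
proof -
  let ?bisimilar = "\<exists>R. bisimulation L \<M> \<N> R \<and> ((M, a), (N, b)) \<in> R"
  have pos: "position L \<M> \<N> ((M, a), (N, b))"
    using assms(1-3) by (simp add: position_def)
  have "Eloise_wins_MEF L \<M> (M, a) \<N> (N, b) \<longleftrightarrow> ?bisimilar"
    using bisimulation_imp_Eloise_wins Eloise_wins_imp_bisimulation[OF _ pos] by blast
  moreover have "L_infty_equivalent TYPE('i) L \<M> (M, a) \<N> (N, b) \<longleftrightarrow> ?bisimilar"
  proof
    let ?R = "{(P, Q). position L \<M> \<N> (P, Q) \<and> L_infty_equivalent TYPE('i) L \<M> P \<N> Q}"
    assume "L_infty_equivalent TYPE('i) L \<M> (M, a) \<N> (N, b)"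
    with pos have "((M, a), (N, b)) \<in> ?R" by simp
    moreover from this have "bisimulation L \<M> \<N> ?R"
      by (intro L_infty_equivalence_bisimulation assms) blast
    ultimately show ?bisimilar by blast
  qed (use bisimilar_imp_L_infty_equivalent in blast)
  ultimately show ?thesis by simp
qed

end
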